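(* Let $m\ge 1$, let $\varrho=(\varrho_1,\dots,\varrho_m)$ be a vector of non-negative integers, and let $Q_\varrho=\prod_{j=1}^m\{0,1,\dots,\varrho_j\}$. There is a one-to-one correspondence between matricubes with ground set $Q_\varrho$ and coherent complexes of matroids indexed by $Q_\varrho$, given by sending a matricube to the family $(\mathrm M_a)_{a\in Q_\varrho}$ of its local matroids.
   Context: $Q_\varrho$ is ordered coordinatewise: $x\preceq y$ iff $x_j\le y_j$ for all $j$. The operations $\vee$ and $\wedge$ are the coordinatewise maximum and minimum. $e_i$ is the $i$-th unit vector. For $a\in Q_\varrho$, $I_a=\{i\in\{1,\dots,m\}: a+e_i\in Q_\varrho\}=\{i: a_i<\varrho_i\}$. A matricube with ground set $Q_\varrho$ is given by a function $\mathbf r:Q_\varrho\to\mathbb Z$ (its rank function) such that: (R1) $\mathbf r(0)=0$ and $\mathbf r(t\,e_i)-\mathbf r((t-1)e_i)\le 1$ for all $1\le i\le m$ and $1\le t\le \varrho_i$; (R2) $x\preceq y$ implies $\mathbf r(x)\le\mathbf r(y)$; (R3) $\mathbf r(x)+\mathbf r(y)\ge \mathbf r(x\vee y)+\mathbf r(x\wedge y)$ for all $x,y\in Q_\varrho$. The local matroid $\mathrm M_a$ of a matricube at $a\in Q_\varrho$ is the matroid on the set $I_a$ with rank function $\mathbf r_a(X)=\mathbf r\bigl(a+\sum_{i\in X}e_i\bigr)-\mathbf r(a)$, $X\subseteq I_a$. A coherent complex of matroids indexed by $Q_\varrho$ is a family $(\mathrm M_a)_{a\in Q_\varrho}$ with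 $\mathrm M_a$ a matroid on the set $I_a$, with rank function $\mathbf r_a$, such that: (CC1) for all $i\in\{1,\dots,m\}$ and $0\le t<\varrho_i$, $\mathbf r_{t\,e_i}(\{i\})\le 1$; (CC2) for all $a\in Q_\varrho$ and $i\in I_a$: if $a_i=\varrho_i-1$, then $\mathrm M_{a+e_i}=\mathrm M_a/i$ (the contraction of $i$ in $\mathrm M_a$); otherwise $\mathrm M_{a+e_i}$ is a single-element extension of $\mathrm M_a/i$ by an element denoted $i$, that is, $\mathrm M_{a+e_i}$ is a matroid on $I_a$ whose deletion of $i$ is $\mathrm M_a/i$. *)

theory Defs
  imports Main "HOL-Library.FuncSet" "HOL-Library.Function_Algebras"
begin

section \<open>The hypercuboid\<close>

text \<open>
  Points are functions \<open>nat \<Rightarrow> nat\<close> with coordinates indexed by \<open>{1..m}\<close> and set to \<open>0\<close>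
  elsewhere.  Hence the coordinatewise order, maximum, minimum, zero and sum are the library
  operations \<open>\<le>\<close>, \<open>sup\<close>, \<open>inf\<close>, \<open>0\<close> and \<open>+\<close> on functions.
  Only the values of \<open>\<rho>\<close> on \<open>{1..m}\<close> matter.
\<close>

definition hypercuboid :: "nat \<Rightarrow> (nat \<Rightarrow> nat) \<Rightarrow> (nat \<Rightarrow> nat) set" where
  "hypercuboid m \<rho> = {x. (\<forall>j\<in>{1..m}. x j \<le> \<rho> j) \<and> (\<forall>j. j \<notin> {1..m} \<longrightarrow> x j = 0)}"

definition unit_vec :: "nat \<Rightarrow> nat \<Rightarrow> nat" where
  "unit_vec i = (\<lambda>j. if j = i then 1 else 0)"

definition scale :: "nat \<Rightarrow> (nat \<Rightarrow> nat) \<Rightarrow> nat \<Rightarrow> nat" where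
  "scale t x = (\<lambda>j. t * x j)"

definition free_dirs :: "nat \<Rightarrow> (nat \<Rightarrow> nat) \<Rightarrow> (nat \<Rightarrow> nat) \<Rightarrow> nat set" where
  "free_dirs m \<rho> a = {i \<in> {1..m}. a + unit_vec i \<in> hypercuboid m \<rho>}"


section \<open>Matroids\<close>

text \<open>
  A matroid is a finite ground set with a rank function on its subsets.  The rank function is
  \<open>undefined\<close> off the subsets of the ground set, so that two matroids are the same exactly when
  they are equal as records.
\<close>

record 'a matroid =
  ground :: "'a set"
  rk :: "'a set \<Rightarrow> int"

definition is_matroid :: "'a matroid \<Rightarrow> bool" where
  "is_matroid M \<longleftrightarrow>
     finite (ground M) \<and>
     rk M \<in> extensional (Pow (ground M)) \<and>
     (\<forall>X. X \<subseteq> ground M \<longrightarrow> 0 \<le> rk M X \<and> rk M X \<le> int (card X)) \<and>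
     (\<forall>X Y. X \<subseteq> Y \<longrightarrow> Y \<subseteq> ground M \<longrightarrow> rk M X \<le> rk M Y) \<and>
     (\<forall>X Y. X \<subseteq> ground M \<longrightarrow> Y \<subseteq> ground M \<longrightarrow>
        rk M (X \<union> Y) + rk M (X \<inter> Y) \<le> rk M X + rk M Y)"

definition deletion :: "'a matroid \<Rightarrow> 'a \<Rightarrow> 'a matroid" where
  "deletion M i =
     \<lparr>ground = ground M - {i},
      rk = restrict (rk M) (Pow (ground M - {i}))\<rparr>"

definition contraction :: "'a matroid \<Rightarrow> 'a \<Rightarrow> 'a matroid" where
  "contraction M i =
     \<lparr>ground = ground M - {i},
      rk = (\<lambda>X\<in>Pow (ground M - {i}). rk M (insert i X) - rk M {i})\<rparr>"

definition single_element_extension :: "'a matroid \<Rightarrow> 'a \<Rightarrow> 'a matroid \<Rightarrow> bool" where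
  "single_element_extension M i N \<longleftrightarrow>
     is_matroid N \<and> i \<notin> ground M \<and> ground N = insert i (ground M) \<and> deletion N i = M"


section \<open>Matricubes and coherent complexes of matroids\<close>

text \<open>
  Functions and families indexed by the hypercuboid are \<open>undefined\<close> outside it, which makes
  equality of functions the same as equality on the hypercuboid.
\<close>

definition matricube :: "nat \<Rightarrow> (nat \<Rightarrow> nat) \<Rightarrow> ((nat \<Rightarrow> nat) \<Rightarrow> int) \<Rightarrow> bool" where
  "matricube m \<rho> r \<longleftrightarrow>
     r \<in> extensional (hypercuboid m \<rho>) \<and>
     r 0 = 0 \<and>
     (\<forall>i\<in>{1..m}. \<forall>t\<in>{1..\<rho> i}.
        r (scale t (unit_vec i)) - r (scale (t - 1) (unit_vec i)) \<le> 1) \<and>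
     (\<forall>x\<in>hypercuboid m \<rho>. \<forall>y\<in>hypercuboid m \<rho>. x \<le> y \<longrightarrow> r x \<le> r y) \<and>
     (\<forall>x\<in>hypercuboid m \<rho>. \<forall>y\<in>hypercuboid m \<rho>.
        r x + r y \<ge> r (sup x y) + r (inf x y))"

definition local_matroid ::
    "nat \<Rightarrow> (nat \<Rightarrow> nat) \<Rightarrow> ((nat \<Rightarrow> nat) \<Rightarrow> int) \<Rightarrow> (nat \<Rightarrow> nat) \<Rightarrow> nat matroid" where
  "local_matroid m \<rho> r a =
     \<lparr>ground = free_dirs m \<rho> a,
      rk = (\<lambda>X\<in>Pow (free_dirs m \<rho> a). r (a + (\<Sum>i\<in>X. unit_vec i)) - r a)\<rparr>"

text \<open>
  In the last two clauses, \<open>a i + 1 = \<rho> i\<close> expresses \<open>a i = \<rho> i - 1\<close> without truncated subtraction.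
\<close>

definition coherent_complex ::
    "nat \<Rightarrow> (nat \<Rightarrow> nat) \<Rightarrow> ((nat \<Rightarrow> nat) \<Rightarrow> nat matroid) \<Rightarrow> bool" where
  "coherent_complex m \<rho> M \<longleftrightarrow>
     M \<in> extensional (hypercuboid m \<rho>) \<and>
     (\<forall>a\<in>hypercuboid m \<rho>. is_matroid (M a) \<and> ground (M a) = free_dirs m \<rho> a) \<and>
     (\<forall>i\<in>{1..m}. \<forall>t<\<rho> i. rk (M (scale t (unit_vec i))) {i} \<le> 1) \<and>
     (\<forall>a\<in>hypercuboid m \<rho>. \<forall>i\<in>free_dirs m \<rho> a.
        (a i + 1 = \<rho> i \<longrightarrow> M (a + unit_vec i) = contraction (M a) i) \<and>
        (a i + 1 \<noteq> \<rho> i \<longrightarrow>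
           single_element_extension (contraction (M a) i) i (M (a + unit_vec i))))"

end

theory Submission
  imports Defs
begin

text \<open>
  A rank function \<open>r\<close> and its local matroids carry the same information because the rank of a
  singleton \<open>{i}\<close> in the local matroid at \<open>a\<close> is the increment \<open>r (a + e\<^sub>i) - r a\<close>: integrating these
  increments along a lattice path from the origin recovers \<open>r\<close>, which gives injectivity.

  That the local matroids of a matricube form a coherent complex is a matter of reading the axioms
  at the points \<open>a + e\<^sub>X\<close>, where \<open>e\<^sub>X\<close> is the indicator vector of \<open>X\<close>,
  since \<open>X \<mapsto> a + e\<^sub>X\<close> turns union and intersection into join and meet. The only inequality that needs an argument is that every increment is at most \<open>1\<close>, while a matricube
  is only required to satisfy this on the coordinate axes; submodularity pushes
  this bound to the whole hypercuboid (\<open>matricube_increment_le_1\<close>).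

  For surjectivity one integrates the singleton ranks of a coherent complex \<open>M\<close>. Write \<open>r\<^sub>a\<close> for the
  rank function of \<open>M\<^sub>a\<close>. The result does not depend on the path, because the relation between
  \<open>M\<^bsub>a+e\<^sub>i\<^esub>\<close> and the contraction of \<open>i\<close> in \<open>M\<^sub>a\<close> gives
  \<open>r\<^sub>a {i} + r\<^bsub>a+e\<^sub>i\<^esub> {j} = r\<^sub>a {i, j} = r\<^sub>a {j} + r\<^bsub>a+e\<^sub>j\<^esub> {i}\<close>, so the increments are closed around
  elementary squares and have a potential \<open>r\<close> (\<open>closed_increments_have_potential\<close>). Submodularity
  of the matroid \<open>M\<^sub>a\<close> on pairs says that an increment in direction \<open>i\<close> can only decrease when one
  moves in a direction \<open>j \<noteq> i\<close>; on a product of chains this local condition already implies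
  submodularity (\<open>submodular_if_locally_submodular\<close>). Repeated contraction shows that
  the local matroids of \<open>r\<close> are the matroids of the given complex, on all subsets
  and not only on singletons (\<open>potential_computes_ranks\<close>).
\<close>

section \<open>Moving in the hypercuboid\<close>

definition indicator_vec :: "nat set \<Rightarrow> nat \<Rightarrow> nat" where
  "indicator_vec X = (\<lambda>j. if j \<in> X then 1 else 0)"

lemma sum_unit_vec: "finite X \<Longrightarrow> (\<Sum>i\<in>X. unit_vec i) = indicator_vec X"
  by (induction X rule: finite_induct) (auto simp: indicator_vec_def unit_vec_def fun_eq_iff)

lemma indicator_vec_empty [simp]: "indicator_vec {} = 0"
  by (auto simp: indicator_vec_def fun_eq_iff)

lemma indicator_vec_singleton [simp]: "indicator_vec {i} = unit_vec i"
  by (auto simp: indicator_vec_def unit_vec_def fun_eq_iff)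

lemma indicator_vec_insert:
  "i \<notin> X \<Longrightarrow> indicator_vec (insert i X) = unit_vec i + indicator_vec X"
  by (auto simp: indicator_vec_def unit_vec_def fun_eq_iff)

lemma sup_indicator_vec:
  "sup (a + indicator_vec X) (a + indicator_vec Y) = a + indicator_vec (X \<union> Y)"
  by (auto simp: indicator_vec_def fun_eq_iff sup_max)

lemma inf_indicator_vec:
  "inf (a + indicator_vec X) (a + indicator_vec Y) = a + indicator_vec (X \<inter> Y)"
  by (auto simp: indicator_vec_def fun_eq_iff inf_min)

lemma zero_in_hypercuboid [simp]: "0 \<in> hypercuboid m \<rho>"
  by (simp add: hypercuboid_def)

lemma hypercuboid_downward_closed:
  assumes y: "y \<in> hypercuboid m \<rho>" and "x \<le> y"
  shows "x \<in> hypercuboid m \<rho>"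
proof -
  have le: "x j \<le> y j" for j
    using \<open>x \<le> y\<close> by (rule le_funD)
  have "x j \<le> \<rho> j" if "j \<in> {1..m}" for j
    using y that order_trans[OF le[of j]] by (simp add: hypercuboid_def)
  moreover have "x j = 0" if "j \<notin> {1..m}" for j
    using y that le[of j] unfolding hypercuboid_def by auto
  ultimately show ?thesis
    by (simp add: hypercuboid_def)
qed

lemma finite_free_dirs [simp]: "finite (free_dirs m \<rho> a)"
  by (simp add: free_dirs_def)

lemma mem_free_dirs_iff:
  "a \<in> hypercuboid m \<rho> \<Longrightarrow> i \<in> free_dirs m \<rho> a \<longleftrightarrow> i \<in> {1..m} \<and> a i < \<rho> i"
  by (auto simp: free_dirs_def hypercuboid_def unit_vec_def)

lemma free_dirs_step:
  assumes "a \<in> hypercuboid m \<rho>" "i \<in> free_dirs m \<rho> a"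
  shows "free_dirs m \<rho> (a + unit_vec i) =
    (if a i + 1 = \<rho> i then free_dirs m \<rho> a - {i} else free_dirs m \<rho> a)"
proof -
  have "a + unit_vec i \<in> hypercuboid m \<rho>"
    using assms by (simp add: free_dirs_def)
  then show ?thesis
    using assms by (auto simp: mem_free_dirs_iff unit_vec_def split: if_splits)
qed

lemma add_indicator_vec_in_hypercuboid:
  assumes a: "a \<in> hypercuboid m \<rho>" and X: "X \<subseteq> free_dirs m \<rho> a"
  shows "a + indicator_vec X \<in> hypercuboid m \<rho>"
proof -
  have "j \<in> {1..m} \<and> a j < \<rho> j" if "j \<in> X" for j
    using X that mem_free_dirs_iff[OF a] by blast
  then show ?thesis
    using a by (auto simp: hypercuboid_def indicator_vec_def Suc_le_eq)
qed

lemma add_unit_vec_in_hypercuboid_dest: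
  assumes "a + unit_vec i \<in> hypercuboid m \<rho>"
  shows "a \<in> hypercuboid m \<rho>" "i \<in> free_dirs m \<rho> a"
proof -
  show "a \<in> hypercuboid m \<rho>"
    using assms by (rule hypercuboid_downward_closed) (simp add: le_fun_def)
  have "i \<in> {1..m}"
    using assms by (auto simp: hypercuboid_def unit_vec_def)
  then show "i \<in> free_dirs m \<rho> a"
    using assms by (simp add: free_dirs_def)
qed

lemma hypercuboid_induct [consumes 1, case_names zero step]:
  assumes "x \<in> hypercuboid m \<rho>"
    and zero: "P 0"
    and step: "\<And>x i. x + unit_vec i \<in> hypercuboid m \<rho> \<Longrightarrow> P x \<Longrightarrow> P (x + unit_vec i)"
  shows "P x"
  using assms(1)
proof (induction "\<Sum>j\<in>{1..m}. x j" arbitrary: x)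
  case 0
  then have "x = 0"
    by (auto simp: hypercuboid_def fun_eq_iff)
  then show "P x"
    using zero by simp
next
  case (Suc n)
  then obtain i where i: "i \<in> {1..m}" "x i \<noteq> 0"
    by (metis Zero_not_Suc sum.neutral)
  define y where "y = x(i := x i - 1)"
  have x: "x = y + unit_vec i"
    using i by (auto simp: y_def unit_vec_def fun_eq_iff)
  have "(\<Sum>j\<in>{1..m}. x j) = (\<Sum>j\<in>{1..m}. y j) + (\<Sum>j\<in>{1..m}. unit_vec i j)"
    by (simp add: x sum.distrib)
  also have "(\<Sum>j\<in>{1..m}. unit_vec i j) = 1"
    using i by (simp add: unit_vec_def)
  finally have "n = (\<Sum>j\<in>{1..m}. y j)"
    using Suc.hyps(2) by simp
  moreover have "y \<in> hypercuboid m \<rho>"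
    using Suc.prems x add_unit_vec_in_hypercuboid_dest(1) by blast
  ultimately have "P y"
    using Suc.hyps(1) by blast
  then show ?case
    using step Suc.prems x by simp
qed

section \<open>Local matroids of a matricube\<close>

lemma ground_local_matroid [simp]: "ground (local_matroid m \<rho> r a) = free_dirs m \<rho> a"
  by (simp add: local_matroid_def)

lemma rk_local_matroid:
  "rk (local_matroid m \<rho> r a) =
    (\<lambda>X\<in>Pow (free_dirs m \<rho> a). r (a + indicator_vec X) - r a)"
  unfolding local_matroid_def
  by (auto simp: sum_unit_vec finite_subset[OF _ finite_free_dirs] intro!: restrict_ext)

lemma matricube_mono:
  "matricube m \<rho> r \<Longrightarrow> x \<in> hypercuboid m \<rho> \<Longrightarrow> y \<in> hypercuboid m \<rho> \<Longrightarrow> x \<le> y \<Longrightarrow> r x \<le> r y"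
  by (simp add: matricube_def)

lemma matricube_submodular:
  "matricube m \<rho> r \<Longrightarrow> x \<in> hypercuboid m \<rho> \<Longrightarrow> y \<in> hypercuboid m \<rho> \<Longrightarrow>
    r (sup x y) + r (inf x y) \<le> r x + r y"
  by (simp add: matricube_def)

text \<open>
  The points \<open>x\<close> and \<open>(x\<^sub>i + 1) e\<^sub>i\<close> have join \<open>x + e\<^sub>i\<close> and meet \<open>x\<^sub>i e\<^sub>i\<close>, so submodularity bounds
  the increment at \<open>x\<close> by the one at its projection to the \<open>i\<close>-th axis.
\<close>

lemma matricube_increment_le_1:
  assumes r: "matricube m \<rho> r" and x: "x + unit_vec i \<in> hypercuboid m \<rho>"
  shows "r (x + unit_vec i) - r x \<le> 1"
proof -
  let ?y = "scale (x i + 1) (unit_vec i)"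
  have xQ: "x \<in> hypercuboid m \<rho>" and "i \<in> free_dirs m \<rho> x"
    using add_unit_vec_in_hypercuboid_dest[OF x] by auto
  then have i: "i \<in> {1..m}" "x i < \<rho> i"
    by (auto simp: mem_free_dirs_iff)
  have yQ: "?y \<in> hypercuboid m \<rho>"
    using i by (auto simp: hypercuboid_def scale_def unit_vec_def)
  have "sup x ?y = x + unit_vec i"
    by (auto simp: fun_eq_iff scale_def unit_vec_def sup_max)
  moreover have "inf x ?y = scale (x i) (unit_vec i)"
    by (auto simp: fun_eq_iff scale_def unit_vec_def inf_min)
  ultimately have "r (x + unit_vec i) + r (scale (x i) (unit_vec i)) \<le> r x + r ?y"
    using matricube_submodular[OF r xQ yQ] by simp
  moreover have "\<forall>t\<in>{1..\<rho> i}. r (scale t (unit_vec i)) - r (scale (t - 1) (unit_vec i)) \<le> 1"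
    using r i unfolding matricube_def by blast
  then have "r ?y - r (scale (x i) (unit_vec i)) \<le> 1"
    using i by (auto dest: bspec[where x = "x i + 1"])
  ultimately show ?thesis
    by linarith
qed

lemma matricube_rank_indicator_le_card:
  assumes r: "matricube m \<rho> r" and a: "a \<in> hypercuboid m \<rho>"
    and "finite X" and "X \<subseteq> free_dirs m \<rho> a"
  shows "r (a + indicator_vec X) - r a \<le> int (card X)"
  using assms(3,4)
proof (induction X rule: finite_induct)
  case (insert i X)
  have eq: "a + indicator_vec (insert i X) = a + indicator_vec X + unit_vec i"
    using insert.hyps by (simp add: indicator_vec_insert ac_simps)
  have "a + indicator_vec X + unit_vec i \<in> hypercuboid m \<rho>"
    using add_indicator_vec_in_hypercuboid[OF a insert.prems] eq by simp
  then have "r (a + indicator_vec X + unit_vec i) - r (a + indicator_vec X) \<le> 1"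
    by (intro matricube_increment_le_1[OF r])
  moreover have "r (a + indicator_vec X) - r a \<le> int (card X)"
    using insert.prems by (intro insert.IH) simp
  ultimately show "r (a + indicator_vec (insert i X)) - r a \<le> int (card (insert i X))"
    using insert.hyps by (simp add: eq)
qed simp

lemma is_matroid_local_matroid:
  assumes r: "matricube m \<rho> r" and a: "a \<in> hypercuboid m \<rho>"
  shows "is_matroid (local_matroid m \<rho> r a)"
  unfolding is_matroid_def ground_local_matroid rk_local_matroid
proof (intro conjI allI impI)
  let ?I = "free_dirs m \<rho> a"
  note inQ = add_indicator_vec_in_hypercuboid[OF a]
  fix X assume X: "X \<subseteq> ?I"
  have "r a \<le> r (a + indicator_vec X)"
    by (rule matricube_mono[OF r a inQ[OF X]]) (simp add: le_fun_def)
  then show "0 \<le> (\<lambda>X\<in>Pow ?I. r (a + indicator_vec X) - r a) X"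
    using X by simp
  show "(\<lambda>X\<in>Pow ?I. r (a + indicator_vec X) - r a) X \<le> int (card X)"
    using X matricube_rank_indicator_le_card[OF r a] finite_subset[OF X] by simp
next
  let ?I = "free_dirs m \<rho> a"
  note inQ = add_indicator_vec_in_hypercuboid[OF a]
  fix X Y assume XY: "X \<subseteq> Y" "Y \<subseteq> ?I"
  have "r (a + indicator_vec X) \<le> r (a + indicator_vec Y)"
    using XY by (intro matricube_mono[OF r] inQ) (auto simp: le_fun_def indicator_vec_def)
  then show "(\<lambda>X\<in>Pow ?I. r (a + indicator_vec X) - r a) X
      \<le> (\<lambda>X\<in>Pow ?I. r (a + indicator_vec X) - r a) Y"
    using XY by auto
next
  let ?I = "free_dirs m \<rho> a"
  note inQ = add_indicator_vec_in_hypercuboid[OF a]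
  fix X Y assume XY: "X \<subseteq> ?I" "Y \<subseteq> ?I"
  then have "X \<inter> Y \<subseteq> ?I"
    by auto
  then show "(\<lambda>X\<in>Pow ?I. r (a + indicator_vec X) - r a) (X \<union> Y)
      + (\<lambda>X\<in>Pow ?I. r (a + indicator_vec X) - r a) (X \<inter> Y)
      \<le> (\<lambda>X\<in>Pow ?I. r (a + indicator_vec X) - r a) X
      + (\<lambda>X\<in>Pow ?I. r (a + indicator_vec X) - r a) Y"
    using XY matricube_submodular[OF r inQ[OF XY(1)] inQ[OF XY(2)]]
    by (simp add: sup_indicator_vec inf_indicator_vec)
qed auto

text \<open>
  Contracting \<open>i\<close> moves the base point from \<open>a\<close> to \<open>a + e\<^sub>i\<close>. The right-hand side is \<open>local_matroid\<close> at
  the new base point except that \<open>i\<close> is always missing from the ground set.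
\<close>

lemma contraction_local_matroid:
  assumes i: "i \<in> free_dirs m \<rho> a"
  shows "contraction (local_matroid m \<rho> r a) i =
    \<lparr>ground = free_dirs m \<rho> a - {i},
     rk = (\<lambda>X\<in>Pow (free_dirs m \<rho> a - {i}).
       r (a + unit_vec i + indicator_vec X) - r (a + unit_vec i))\<rparr>"
proof -
  have "rk (local_matroid m \<rho> r a) (insert i X) - rk (local_matroid m \<rho> r a) {i} =
      r (a + unit_vec i + indicator_vec X) - r (a + unit_vec i)"
    if "X \<in> Pow (free_dirs m \<rho> a - {i})" for X
  proof -
    have "indicator_vec (insert i X) = unit_vec i + indicator_vec X"
      using that by (intro indicator_vec_insert) auto
    moreover have "insert i X \<subseteq> free_dirs m \<rho> a"
      using that i by auto
    ultimately show ?thesis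
      using i by (simp add: rk_local_matroid ac_simps)
  qed
  then show ?thesis
    unfolding contraction_def ground_local_matroid by (auto intro!: restrict_ext)
qed

lemma local_matroid_eqI:
  assumes "ground N = free_dirs m \<rho> a"
    and "rk N = (\<lambda>X\<in>Pow (free_dirs m \<rho> a). r (a + indicator_vec X) - r a)"
  shows "local_matroid m \<rho> r a = N"
  using assms by (intro matroid.equality) (simp_all add: rk_local_matroid)

lemma coherent_complex_of_matricube:
  assumes r: "matricube m \<rho> r"
  shows "coherent_complex m \<rho> (\<lambda>a\<in>hypercuboid m \<rho>. local_matroid m \<rho> r a)"
  unfolding coherent_complex_def
proof (intro conjI ballI allI impI)
  fix i t assume i: "i \<in> {1..m}" and t: "t < \<rho> i"
  let ?x = "scale t (unit_vec i)"
  have x: "?x + unit_vec i \<in> hypercuboid m \<rho>"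
    using i t by (auto simp: hypercuboid_def scale_def unit_vec_def)
  note add_unit_vec_in_hypercuboid_dest[OF x]
  then show "rk ((\<lambda>a\<in>hypercuboid m \<rho>. local_matroid m \<rho> r a) ?x) {i} \<le> 1"
    using matricube_increment_le_1[OF r x] by (simp add: rk_local_matroid)
next
  fix a i assume a: "a \<in> hypercuboid m \<rho>" and i: "i \<in> free_dirs m \<rho> a"
  have b: "a + unit_vec i \<in> hypercuboid m \<rho>"
    using i by (simp add: free_dirs_def)
  note step = free_dirs_step[OF a i]
  {
    assume "a i + 1 = \<rho> i"
    then have "local_matroid m \<rho> r (a + unit_vec i) = contraction (local_matroid m \<rho> r a) i"
      by (intro local_matroid_eqI) (simp_all add: step contraction_local_matroid[OF i])
    then show "(\<lambda>a\<in>hypercuboid m \<rho>. local_matroid m \<rho> r a) (a + unit_vec i) =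
        contraction ((\<lambda>a\<in>hypercuboid m \<rho>. local_matroid m \<rho> r a) a) i"
      using a b by simp
  }
  assume "a i + 1 \<noteq> \<rho> i"
  then have same: "free_dirs m \<rho> (a + unit_vec i) = free_dirs m \<rho> a"
    using step by simp
  have "deletion (local_matroid m \<rho> r (a + unit_vec i)) i = contraction (local_matroid m \<rho> r a) i"
    unfolding contraction_local_matroid[OF i] deletion_def ground_local_matroid same
    by (auto simp: rk_local_matroid same restrict_def fun_eq_iff)
  moreover have "is_matroid (local_matroid m \<rho> r (a + unit_vec i))"
    by (rule is_matroid_local_matroid[OF r b])
  ultimately show "single_element_extension
      (contraction ((\<lambda>a\<in>hypercuboid m \<rho>. local_matroid m \<rho> r a) a) i) i
      ((\<lambda>a\<in>hypercuboid m \<rho>. local_matroid m \<rho> r a) (a + unit_vec i))"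
    using a b i same
    by (auto simp: single_element_extension_def contraction_local_matroid[OF i])
qed (auto simp: is_matroid_local_matroid[OF r])

lemma matricube_eqI:
  assumes r: "matricube m \<rho> r" and s: "matricube m \<rho> s"
    and eq: "\<And>a. a \<in> hypercuboid m \<rho> \<Longrightarrow> local_matroid m \<rho> r a = local_matroid m \<rho> s a"
  shows "r = s"
proof -
  have "r x = s x" if "x \<in> hypercuboid m \<rho>" for x
    using that
  proof (induction rule: hypercuboid_induct)
    case zero
    show "r 0 = s 0"
      using r s by (simp add: matricube_def)
  next
    case (step x i)
    note x = add_unit_vec_in_hypercuboid_dest[OF step.hyps]
    have "rk (local_matroid m \<rho> r x) {i} = rk (local_matroid m \<rho> s x) {i}"
      using eq x by simp
    then show "r (x + unit_vec i) = s (x + unit_vec i)"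
      using step.IH x by (simp add: rk_local_matroid)
  qed
  then show ?thesis
    using r s by (intro extensionalityI[of _ "hypercuboid m \<rho>"]) (auto simp: matricube_def)
qed

section \<open>Integrating increments\<close>

text \<open>
  The potential is built one coordinate at a time: first by the potential on the points with
  \<open>k\<close>-th coordinate \<open>0\<close>, then straight up in direction \<open>k\<close>. In another direction \<open>i\<close> its increment
  is right: by closedness, moving by \<open>e\<^sub>i\<close> changes each summand of the vertical sum by the difference
  of the \<open>i\<close>-increments at two consecutive heights, and these differences telescope.
\<close>

lemma potential_on_coordinate_subspace:
  fixes d :: "(nat \<Rightarrow> nat) \<Rightarrow> nat \<Rightarrow> int"
  assumes "finite S"
    and closed: "\<And>a i j. i \<noteq> j \<Longrightarrow> a + unit_vec i + unit_vec j \<in> hypercuboid m \<rho> \<Longrightarrow>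
      d a i + d (a + unit_vec i) j = d a j + d (a + unit_vec j) i"
  shows "\<exists>r. r 0 = 0 \<and> (\<forall>a i. i \<in> S \<longrightarrow> (\<forall>j. j \<notin> S \<longrightarrow> a j = 0) \<longrightarrow>
    a + unit_vec i \<in> hypercuboid m \<rho> \<longrightarrow> r (a + unit_vec i) = r a + d a i)"
  using assms(1)
proof (induction S rule: finite_induct)
  case empty
  show ?case
    by (intro exI[of _ "\<lambda>_. 0"]) simp
next
  case (insert k S)
  then obtain r where r0: "r 0 = 0"
    and r: "\<And>a i. i \<in> S \<Longrightarrow> (\<forall>j. j \<notin> S \<longrightarrow> a j = 0) \<Longrightarrow>
      a + unit_vec i \<in> hypercuboid m \<rho> \<Longrightarrow> r (a + unit_vec i) = r a + d a i"
    by blast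
  define r' where "r' x = r (x(k := 0)) + (\<Sum>t<x k. d (x(k := t)) k)" for x
  have "r' 0 = 0"
  proof -
    have "(0 :: nat \<Rightarrow> nat)(k := 0) = 0"
      by auto
    then show ?thesis
      by (simp add: r'_def r0)
  qed
  moreover have "r' (a + unit_vec i) = r' a + d a i"
    if i: "i \<in> insert k S" and a: "\<forall>j. j \<notin> insert k S \<longrightarrow> a j = 0"
      and Q: "a + unit_vec i \<in> hypercuboid m \<rho>" for a i
  proof (cases "i = k")
    case True
    have "(a + unit_vec k)(k := t) = a(k := t)" for t
      by (auto simp: unit_vec_def)
    moreover have "(a + unit_vec k) k = Suc (a k)"
      by (simp add: unit_vec_def)
    ultimately show ?thesis
      by (simp add: r'_def True)
  next
    case False
    then have iS: "i \<in> S"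
      using i by simp
    have upd: "(a + unit_vec i)(k := t) = a(k := t) + unit_vec i" for t
      using False by (auto simp: unit_vec_def)
    have k: "(a + unit_vec i) k = a k"
      using False by (simp add: unit_vec_def)
    have below: "a(k := t) + unit_vec i \<in> hypercuboid m \<rho>" if "t \<le> a k" for t
      using Q by (rule hypercuboid_downward_closed) (use that in \<open>simp add: le_fun_def\<close>)
    have "r ((a(k := 0)) + unit_vec i) = r (a(k := 0)) + d (a(k := 0)) i"
      using a iS below[of 0] by (intro r) auto
    moreover have "d (a(k := t) + unit_vec i) k =
        d (a(k := t)) k + (d (a(k := Suc t)) i - d (a(k := t)) i)" if t: "t < a k" for t
    proof -
      have up: "a(k := t) + unit_vec k = a(k := Suc t)"
        by (auto simp: unit_vec_def)
      have "a(k := t) + unit_vec i + unit_vec k = a(k := Suc t) + unit_vec i"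
        by (simp add: up[symmetric] ac_simps)
      also have "\<dots> \<in> hypercuboid m \<rho>"
        using t by (intro below) simp
      finally show ?thesis
        using closed[OF False] up by fastforce
    qed
    then have "(\<Sum>t<a k. d (a(k := t) + unit_vec i) k) =
        (\<Sum>t<a k. d (a(k := t)) k) + (d a i - d (a(k := 0)) i)"
      using sum_lessThan_telescope[of "\<lambda>t. d (a(k := t)) i" "a k"] by (simp add: sum.distrib)
    ultimately show ?thesis
      by (simp add: r'_def upd k del: plus_fun_apply)
  qed
  ultimately show ?case
    by blast
qed

lemma closed_increments_have_potential:
  fixes d :: "(nat \<Rightarrow> nat) \<Rightarrow> nat \<Rightarrow> int"
  assumes "\<And>a i j. i \<noteq> j \<Longrightarrow> a + unit_vec i + unit_vec j \<in> hypercuboid m \<rho> \<Longrightarrow>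
      d a i + d (a + unit_vec i) j = d a j + d (a + unit_vec j) i"
  obtains r where "r 0 = 0"
    and "\<And>a i. a + unit_vec i \<in> hypercuboid m \<rho> \<Longrightarrow> r (a + unit_vec i) = r a + d a i"
proof -
  obtain r where r0: "r 0 = 0"
    and r: "\<forall>a i. i \<in> {1..m} \<longrightarrow> (\<forall>j. j \<notin> {1..m} \<longrightarrow> a j = 0) \<longrightarrow>
      a + unit_vec i \<in> hypercuboid m \<rho> \<longrightarrow> r (a + unit_vec i) = r a + d a i"
    using potential_on_coordinate_subspace[of "{1..m}" m \<rho> d] assms by blast
  have "r (a + unit_vec i) = r a + d a i" if Q: "a + unit_vec i \<in> hypercuboid m \<rho>" for a i
  proof -
    note add_unit_vec_in_hypercuboid_dest[OF Q]
    then have "i \<in> {1..m}" "\<forall>j. j \<notin> {1..m} \<longrightarrow> a j = 0"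
      by (auto simp: mem_free_dirs_iff hypercuboid_def)
    then show ?thesis
      using r Q by blast
  qed
  with r0 show thesis
    by (rule that)
qed

section \<open>From local to global inequalities\<close>

lemma mono_if_locally_mono:
  fixes r :: "(nat \<Rightarrow> nat) \<Rightarrow> int"
  assumes loc: "\<And>a i. a + unit_vec i \<in> hypercuboid m \<rho> \<Longrightarrow> r a \<le> r (a + unit_vec i)"
    and y: "y \<in> hypercuboid m \<rho>" and xy: "x \<le> y"
  shows "r x \<le> r y"
proof -
  have "r x \<le> r (x + z)" if "z \<in> hypercuboid m \<rho>" "x + z \<in> hypercuboid m \<rho>" for z
    using that
  proof (induction rule: hypercuboid_induct)
    case (step z i)
    have "x + (z + unit_vec i) \<in> hypercuboid m \<rho>"
      by (rule step.prems)
    then have Q: "x + z + unit_vec i \<in> hypercuboid m \<rho>"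
      by (simp add: ac_simps)
    have "r x \<le> r (x + z)"
      using add_unit_vec_in_hypercuboid_dest(1)[OF Q] by (rule step.IH)
    then show "r x \<le> r (x + (z + unit_vec i))"
      using loc[OF Q] by (simp add: ac_simps)
  qed simp
  moreover have "y - x \<in> hypercuboid m \<rho>"
    using y by (rule hypercuboid_downward_closed) (simp add: le_fun_def)
  moreover have "x + (y - x) = y"
    using xy by (auto simp: le_fun_def fun_eq_iff)
  ultimately show ?thesis
    using y by metis
qed

text \<open>
  The increment in direction \<open>i\<close> is compared at two points that agree in coordinate \<open>i\<close>, so that the
  path between them only uses the directions \<open>j \<noteq> i\<close> where the local condition applies.
\<close>

lemma increment_antimono:
  fixes r :: "(nat \<Rightarrow> nat) \<Rightarrow> int"
  assumes loc: "\<And>a i j. i \<noteq> j \<Longrightarrow> a + unit_vec i + unit_vec j \<in> hypercuboid m \<rho> \<Longrightarrow>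
      r (a + unit_vec i + unit_vec j) + r a \<le> r (a + unit_vec i) + r (a + unit_vec j)"
    and "v + unit_vec i \<in> hypercuboid m \<rho>" and uv: "u \<le> v" and ui: "u i = v i"
  shows "r (v + unit_vec i) - r v \<le> r (u + unit_vec i) - r u"
proof -
  have "r (u + z + unit_vec i) - r (u + z) \<le> r (u + unit_vec i) - r u"
    if "z \<in> hypercuboid m \<rho>" "z i = 0" "u + z + unit_vec i \<in> hypercuboid m \<rho>" for z
    using that
  proof (induction rule: hypercuboid_induct)
    case (step z j)
    have ij: "i \<noteq> j" and zi: "z i = 0"
      using step.prems(1) by (auto simp: unit_vec_def split: if_splits)
    have "u + (z + unit_vec j) + unit_vec i \<in> hypercuboid m \<rho>"
      by (rule step.prems(2))
    then have Q: "u + z + unit_vec i + unit_vec j \<in> hypercuboid m \<rho>"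
      by (simp add: ac_simps)
    have "r (u + z + unit_vec i) - r (u + z) \<le> r (u + unit_vec i) - r u"
      using step.IH zi add_unit_vec_in_hypercuboid_dest(1)[OF Q] by blast
    then show "r (u + (z + unit_vec j) + unit_vec i) - r (u + (z + unit_vec j))
        \<le> r (u + unit_vec i) - r u"
      using loc[OF ij Q] by (simp add: ac_simps)
  qed simp
  moreover have "v - u \<in> hypercuboid m \<rho>"
    using assms(2) by (rule hypercuboid_downward_closed) (simp add: le_fun_def trans_le_add1)
  moreover have "u + (v - u) = v"
    using uv by (auto simp: le_fun_def fun_eq_iff)
  moreover have "(v - u) i = 0"
    using ui by simp
  ultimately show ?thesis
    using assms(2) by metis
qed

text \<open>
  The paths from \<open>x \<sqinter> y\<close> to \<open>x\<close> and from \<open>y\<close> to \<open>x \<squnion> y\<close> have the same steps, and they only use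
  directions in which \<open>x \<sqinter> y\<close> and \<open>y\<close> agree. So \<open>increment_antimono\<close> compares them step by step.
\<close>

lemma submodular_if_locally_submodular:
  fixes r :: "(nat \<Rightarrow> nat) \<Rightarrow> int"
  assumes loc: "\<And>a i j. i \<noteq> j \<Longrightarrow> a + unit_vec i + unit_vec j \<in> hypercuboid m \<rho> \<Longrightarrow>
      r (a + unit_vec i + unit_vec j) + r a \<le> r (a + unit_vec i) + r (a + unit_vec j)"
    and x: "x \<in> hypercuboid m \<rho>" and y: "y \<in> hypercuboid m \<rho>"
  shows "r (sup x y) + r (inf x y) \<le> r x + r y"
proof -
  let ?u = "inf x y"
  have "r (y + z) - r y \<le> r (?u + z) - r ?u"
    if "z \<in> hypercuboid m \<rho>" "y + z \<in> hypercuboid m \<rho>" "\<forall>i. z i > 0 \<longrightarrow> ?u i = y i" for z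
    using that
  proof (induction rule: hypercuboid_induct)
    case (step z i)
    have "y + (z + unit_vec i) \<in> hypercuboid m \<rho>"
      by (rule step.prems(1))
    then have Q: "y + z + unit_vec i \<in> hypercuboid m \<rho>"
      by (simp add: ac_simps)
    have agree: "\<forall>i. z i > 0 \<longrightarrow> ?u i = y i" "?u i = y i"
      using step.prems(2) by (auto simp: unit_vec_def)
    have "r (y + z) - r y \<le> r (?u + z) - r ?u"
      using step.IH agree add_unit_vec_in_hypercuboid_dest(1)[OF Q] by blast
    moreover have "r (y + z + unit_vec i) - r (y + z) \<le> r (?u + z + unit_vec i) - r (?u + z)"
    proof (rule increment_antimono[OF _ Q])
      show "?u + z \<le> y + z"
        by (simp add: le_fun_def)
      show "(?u + z) i = (y + z) i"
        using agree(2) by simp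
    qed (rule loc)
    ultimately show "r (y + (z + unit_vec i)) - r y \<le> r (?u + (z + unit_vec i)) - r ?u"
      by (simp add: ac_simps)
  qed simp
  moreover have "x - ?u \<in> hypercuboid m \<rho>"
    using x by (rule hypercuboid_downward_closed) (simp add: le_fun_def)
  moreover have "y + (x - ?u) = sup x y" "?u + (x - ?u) = x"
    by (auto simp: fun_eq_iff inf_min sup_max)
  moreover have "sup x y \<in> hypercuboid m \<rho>"
    using x y by (auto simp: hypercuboid_def)
  moreover have "\<forall>i. (x - ?u) i > 0 \<longrightarrow> ?u i = y i"
    by (auto simp: inf_min)
  ultimately have "r (sup x y) - r y \<le> r x - r ?u"
    by metis
  then show ?thesis
    by linarith
qed

section \<open>The matricube of a coherent complex\<close>

lemma coherent_complexD:
  assumes "coherent_complex m \<rho> M" "a \<in> hypercuboid m \<rho>"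
  shows "is_matroid (M a)" "ground (M a) = free_dirs m \<rho> a"
  using assms by (auto simp: coherent_complex_def)

lemma rk_empty: "is_matroid N \<Longrightarrow> rk N {} = 0"
  by (force simp: is_matroid_def)

lemma rk_submodular:
  "is_matroid N \<Longrightarrow> X \<subseteq> ground N \<Longrightarrow> Y \<subseteq> ground N \<Longrightarrow>
    rk N (X \<union> Y) + rk N (X \<inter> Y) \<le> rk N X + rk N Y"
  by (simp add: is_matroid_def)

text \<open>
  Whether or not \<open>i\<close> is still free at \<open>a + e\<^sub>i\<close>, coherence gives the same rank on the
  sets that avoid \<open>i\<close>: the extension only adds information about sets that contain \<open>i\<close>.
\<close>

lemma coherent_complex_rk_step:
  assumes M: "coherent_complex m \<rho> M" and a: "a \<in> hypercuboid m \<rho>"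
    and i: "i \<in> free_dirs m \<rho> a" and X: "X \<subseteq> free_dirs m \<rho> a - {i}"
  shows "rk (M (a + unit_vec i)) X = rk (M a) (insert i X) - rk (M a) {i}"
proof -
  let ?N = "M (a + unit_vec i)"
  have contr: "rk (contraction (M a) i) X = rk (M a) (insert i X) - rk (M a) {i}"
    using X by (simp add: contraction_def coherent_complexD(2)[OF M a])
  show ?thesis
  proof (cases "a i + 1 = \<rho> i")
    case True
    then show ?thesis
      using M a i contr by (simp add: coherent_complex_def)
  next
    case False
    then have ext: "single_element_extension (contraction (M a) i) i ?N"
      using M a i unfolding coherent_complex_def by blast
    then have "rk (contraction (M a) i) X = rk (deletion ?N i) X"
      by (simp add: single_element_extension_def)
    also have "X \<subseteq> ground ?N - {i}"
      using ext X coherent_complexD(2)[OF M a]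
      by (auto simp: single_element_extension_def contraction_def)
    then have "rk (deletion ?N i) X = rk ?N X"
      by (simp add: deletion_def)
    finally show ?thesis
      using contr by simp
  qed
qed

lemma coherent_complex_rk_pair:
  assumes M: "coherent_complex m \<rho> M" and ij: "i \<noteq> j"
    and Q: "a + unit_vec i + unit_vec j \<in> hypercuboid m \<rho>"
  shows "rk (M a) {i} + rk (M (a + unit_vec i)) {j} = rk (M a) {i, j}"
    and "a \<in> hypercuboid m \<rho>" and "{i, j} \<subseteq> free_dirs m \<rho> a"
proof -
  have Q': "a + unit_vec j + unit_vec i \<in> hypercuboid m \<rho>"
    using Q by (simp add: ac_simps)
  note i = add_unit_vec_in_hypercuboid_dest[OF add_unit_vec_in_hypercuboid_dest(1)[OF Q]]
  note j = add_unit_vec_in_hypercuboid_dest[OF add_unit_vec_in_hypercuboid_dest(1)[OF Q']]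
  show "a \<in> hypercuboid m \<rho>" "{i, j} \<subseteq> free_dirs m \<rho> a"
    using i j by auto
  show "rk (M a) {i} + rk (M (a + unit_vec i)) {j} = rk (M a) {i, j}"
    using coherent_complex_rk_step[OF M i, of "{j}"] ij j by simp
qed

text \<open>
  Splitting off one element \<open>i\<close> of \<open>X\<close> replaces \<open>M\<^sub>a\<close> by \<open>M\<^bsub>a+e\<^sub>i\<^esub>\<close>, so the base point has to vary in the
  induction.
\<close>

lemma potential_computes_ranks:
  assumes M: "coherent_complex m \<rho> M"
    and r: "\<And>a i. a + unit_vec i \<in> hypercuboid m \<rho> \<Longrightarrow> r (a + unit_vec i) = r a + rk (M a) {i}"
    and "finite X" and "a \<in> hypercuboid m \<rho>" and "X \<subseteq> free_dirs m \<rho> a"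
  shows "r (a + indicator_vec X) - r a = rk (M a) X"
  using assms(3-5)
proof (induction X arbitrary: a rule: finite_induct)
  case empty
  then show ?case
    using coherent_complexD(1)[OF M] by (simp add: rk_empty)
next
  case (insert i X)
  note a = \<open>a \<in> hypercuboid m \<rho>\<close>
  have i: "i \<in> free_dirs m \<rho> a" and X: "X \<subseteq> free_dirs m \<rho> a - {i}"
    using insert by auto
  have b: "a + unit_vec i \<in> hypercuboid m \<rho>"
    using i by (simp add: free_dirs_def)
  have "X \<subseteq> free_dirs m \<rho> (a + unit_vec i)"
    using X by (auto simp: free_dirs_step[OF a i])
  then have "r (a + unit_vec i + indicator_vec X) - r (a + unit_vec i) = rk (M (a + unit_vec i)) X"
    using insert.IH b by blast
  moreover have "a + indicator_vec (insert i X) = a + unit_vec i + indicator_vec X"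
    using insert.hyps by (simp add: indicator_vec_insert ac_simps)
  ultimately show "r (a + indicator_vec (insert i X)) - r a = rk (M a) (insert i X)"
    using coherent_complex_rk_step[OF M a i X] r[OF b] by simp
qed

lemma coherent_complex_comes_from_matricube:
  assumes M: "coherent_complex m \<rho> M"
  obtains r where "matricube m \<rho> r" "M = (\<lambda>a\<in>hypercuboid m \<rho>. local_matroid m \<rho> r a)"
proof -
  let ?Q = "hypercuboid m \<rho>"
  have "rk (M a) {i} + rk (M (a + unit_vec i)) {j} = rk (M a) {j} + rk (M (a + unit_vec j)) {i}"
    if ij: "i \<noteq> j" and Q: "a + unit_vec i + unit_vec j \<in> ?Q" for a i j
  proof -
    have Q': "a + unit_vec j + unit_vec i \<in> ?Q"
      using Q by (simp add: ac_simps)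
    show ?thesis
      using coherent_complex_rk_pair(1)[OF M ij Q] coherent_complex_rk_pair(1)[OF M ij[symmetric] Q']
      by (simp add: insert_commute)
  qed
  from closed_increments_have_potential[of m \<rho> "\<lambda>a i. rk (M a) {i}", OF this]
  obtain s where s0: "s 0 = 0"
    and s: "\<And>a i. a + unit_vec i \<in> ?Q \<Longrightarrow> s (a + unit_vec i) = s a + rk (M a) {i}"
    by blast
  define r where "r = restrict s ?Q"
  have r0: "r 0 = 0"
    by (simp add: r_def s0)
  have r: "r (a + unit_vec i) = r a + rk (M a) {i}" if "a + unit_vec i \<in> ?Q" for a i
    using s that add_unit_vec_in_hypercuboid_dest(1)[OF that] by (simp add: r_def)
  have loc_mono: "r a \<le> r (a + unit_vec i)" if Q: "a + unit_vec i \<in> ?Q" for a i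
  proof -
    note a = add_unit_vec_in_hypercuboid_dest[OF Q]
    have "0 \<le> rk (M a) {i}"
      using coherent_complexD[OF M a(1)] a(2) by (simp add: is_matroid_def)
    then show ?thesis
      using r[OF Q] by simp
  qed
  have loc_submod:
    "r (a + unit_vec i + unit_vec j) + r a \<le> r (a + unit_vec i) + r (a + unit_vec j)"
    if ij: "i \<noteq> j" and Q: "a + unit_vec i + unit_vec j \<in> ?Q" for a i j
  proof -
    note pair = coherent_complex_rk_pair[OF M ij Q]
    note mat = coherent_complexD[OF M pair(2)]
    have "rk (M a) ({i} \<union> {j}) + rk (M a) ({i} \<inter> {j}) \<le> rk (M a) {i} + rk (M a) {j}"
      using mat(2) pair(3) by (intro rk_submodular[OF mat(1)]) auto
    then have "rk (M a) {i, j} \<le> rk (M a) {i} + rk (M a) {j}"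
      using ij rk_empty[OF mat(1)] by (simp add: insert_commute)
    moreover have "a + unit_vec i \<in> ?Q" "a + unit_vec j \<in> ?Q"
      using pair(3) by (auto simp: free_dirs_def)
    ultimately show ?thesis
      using pair(1) r Q by simp
  qed
  have axis: "r (scale t (unit_vec i)) - r (scale (t - 1) (unit_vec i)) \<le> 1"
    if i: "i \<in> {1..m}" and t: "t \<in> {1..\<rho> i}" for i t
  proof -
    have eq: "scale t (unit_vec i) = scale (t - 1) (unit_vec i) + unit_vec i"
      using t by (auto simp: scale_def unit_vec_def fun_eq_iff)
    have "scale t (unit_vec i) \<in> ?Q"
      using i t by (auto simp: hypercuboid_def scale_def unit_vec_def)
    moreover have "t - 1 < \<rho> i"
      using t by auto
    then have "rk (M (scale (t - 1) (unit_vec i))) {i} \<le> 1"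
      using M i by (simp add: coherent_complex_def)
    ultimately show ?thesis
      using r[of "scale (t - 1) (unit_vec i)" i] eq by simp
  qed
  have "matricube m \<rho> r"
    unfolding matricube_def
  proof (intro conjI ballI impI)
    show "r \<in> extensional ?Q"
      by (simp add: r_def)
    show "r x \<le> r y" if "y \<in> ?Q" "x \<le> y" for x y
      using loc_mono that by (rule mono_if_locally_mono)
    show "r (sup x y) + r (inf x y) \<le> r x + r y" if "x \<in> ?Q" "y \<in> ?Q" for x y
      using loc_submod that by (rule submodular_if_locally_submodular)
  qed (fact r0, fact axis)
  moreover have "M a = local_matroid m \<rho> r a" if a: "a \<in> ?Q" for a
  proof (rule sym, rule local_matroid_eqI)
    note mat = coherent_complexD[OF M a]
    show "ground (M a) = free_dirs m \<rho> a"
      by (rule mat(2))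
    show "rk (M a) = (\<lambda>X\<in>Pow (free_dirs m \<rho> a). r (a + indicator_vec X) - r a)"
    proof (rule extensionalityI[of _ "Pow (free_dirs m \<rho> a)"])
      fix X assume X: "X \<in> Pow (free_dirs m \<rho> a)"
      have "r (a + indicator_vec X) - r a = rk (M a) X"
        using X finite_subset[of X, OF _ finite_free_dirs]
        by (intro potential_computes_ranks[OF M r _ a]) auto
      then show "rk (M a) X = (\<lambda>X\<in>Pow (free_dirs m \<rho> a). r (a + indicator_vec X) - r a) X"
        using X by simp
    qed (use mat in \<open>auto simp: is_matroid_def\<close>)
  qed
  then have "M = (\<lambda>a\<in>?Q. local_matroid m \<rho> r a)"
    using M by (intro extensionalityI[of _ ?Q]) (auto simp: coherent_complex_def)
  ultimately show thesis
    by (rule that)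
qed

section \<open>The correspondence\<close>

theorem theorem8p6:
  fixes m :: nat and \<rho> :: "nat \<Rightarrow> nat"
  assumes "m \<ge> 1"
  shows "bij_betw (\<lambda>r. \<lambda>a\<in>hypercuboid m \<rho>. local_matroid m \<rho> r a)
           {r. matricube m \<rho> r} {M. coherent_complex m \<rho> M}"
proof (rule bij_betw_imageI)
  show "inj_on (\<lambda>r. \<lambda>a\<in>hypercuboid m \<rho>. local_matroid m \<rho> r a) {r. matricube m \<rho> r}"
  proof (rule inj_onI)
    fix r s
    assume rs: "r \<in> {r. matricube m \<rho> r}" "s \<in> {r. matricube m \<rho> r}"
      and eq: "(\<lambda>a\<in>hypercuboid m \<rho>. local_matroid m \<rho> r a) =
        (\<lambda>a\<in>hypercuboid m \<rho>. local_matroid m \<rho> s a)"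
    have "local_matroid m \<rho> r a = local_matroid m \<rho> s a" if "a \<in> hypercuboid m \<rho>" for a
      using fun_cong[OF eq, of a] that by simp
    then show "r = s"
      using rs by (auto intro: matricube_eqI)
  qed
  show "(\<lambda>r. \<lambda>a\<in>hypercuboid m \<rho>. local_matroid m \<rho> r a) ` {r. matricube m \<rho> r} =
      {M. coherent_complex m \<rho> M}"
    by (auto intro: coherent_complex_of_matricube elim!: coherent_complex_comes_from_matricube)
qed

end
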